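(* For any positive integers $r\geq 2$ and $n_1,\dots,n_r$, the complete $r$-partite graph $K_{n_1,\dots,n_r}$ has a cyclic interval $n$-coloring, where $n=\sum_{i=1}^r n_i$.
   Context: $K_{n_1,\dots,n_r}$ is the simple graph whose vertex set is partitioned into independent sets $V_1,\dots,V_r$ with $|V_i|=n_i$, and in which every vertex of $V_i$ is adjacent to every vertex of $V_j$ for all $i\neq j$. A proper $t$-edge coloring of $G$ is a map $\alpha:E(G)\to\{1,\dots,t\}$ with $\alpha(e)\neq\alpha(e')$ for adjacent edges $e,e'$; $S(v,\alpha)$ is the set of colors on edges incident to $v$. A proper $t$-edge coloring $\alpha$ is a cyclic interval $t$-coloring if for every vertex $v$, either $S(v,\alpha)$ or $\{1,\dots,t\}\setminus S(v,\alpha)$ is a set of consecutive integers. *)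

theory Defs
  imports Main "HOL-Library.Disjoint_Sets"
begin

text \<open>A graph is given by its vertex set \<open>V\<close> and its edge set \<open>E\<close>; an edge is the set of its
  two ends.\<close>

definition simple_graph :: "'v set \<Rightarrow> 'v set set \<Rightarrow> bool" where
  "simple_graph V E \<longleftrightarrow> finite V \<and> (\<forall>e\<in>E. e \<subseteq> V \<and> card e = 2)"

definition independent_set :: "'v set set \<Rightarrow> 'v set \<Rightarrow> bool" where
  "independent_set E A \<longleftrightarrow> (\<forall>u\<in>A. \<forall>v\<in>A. {u, v} \<notin> E)"

text \<open>The graph \<open>K\<close> with part sizes \<open>n 1, \<dots>, n r\<close> is only determined up to isomorphism,
  so it is described by a predicate on graphs over an arbitrary vertex type. Values of \<open>n\<close>
  outside \<open>{1..r}\<close> are irrelevant.\<close>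

definition complete_multipartite ::
    "nat \<Rightarrow> (nat \<Rightarrow> nat) \<Rightarrow> 'v set \<Rightarrow> 'v set set \<Rightarrow> bool" where
  "complete_multipartite r n V E \<longleftrightarrow> simple_graph V E \<and>
     (\<exists>P. V = (\<Union>i\<in>{1..r}. P i) \<and> disjoint_family_on P {1..r} \<and>
        (\<forall>i\<in>{1..r}. card (P i) = n i \<and> independent_set E (P i)) \<and>
        (\<forall>i\<in>{1..r}. \<forall>j\<in>{1..r}. i \<noteq> j \<longrightarrow> (\<forall>u\<in>P i. \<forall>v\<in>P j. {u, v} \<in> E)))"

lemma complete_multipartite_exists:
  "complete_multipartite r n (SIGMA i:{1..r}. {1..n i})
     {{(i, a), (j, b)} | i j a b.
        i \<in> {1..r} \<and> j \<in> {1..r} \<and> i \<noteq> j \<and> a \<in> {1..n i} \<and> b \<in> {1..n j}}"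
proof -
  let ?V = "SIGMA i:{1..r}. {1..n i}"
  let ?E = "{{(i, a), (j, b)} | i j a b.
        i \<in> {1..r} \<and> j \<in> {1..r} \<and> i \<noteq> j \<and> a \<in> {1..n i} \<and> b \<in> {1..n j}}"
  let ?P = "\<lambda>i. {i} \<times> {1..n i}"
  have "simple_graph ?V ?E"
    unfolding simple_graph_def by (auto simp: card_insert_if)
  moreover have "?V = (\<Union>i\<in>{1..r}. ?P i)" by auto
  moreover have "disjoint_family_on ?P {1..r}"
    by (auto simp: disjoint_family_on_def)
  moreover have "\<forall>i\<in>{1..r}. card (?P i) = n i \<and> independent_set ?E (?P i)"
    by (auto simp: independent_set_def doubleton_eq_iff)
  moreover have "\<forall>i\<in>{1..r}. \<forall>j\<in>{1..r}. i \<noteq> j \<longrightarrow> (\<forall>u\<in>?P i. \<forall>v\<in>?P j. {u, v} \<in> ?E)"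
    by blast
  ultimately show ?thesis
    unfolding complete_multipartite_def by (intro conjI exI[of _ ?P])
qed

definition proper_edge_coloring :: "'v set set \<Rightarrow> nat \<Rightarrow> ('v set \<Rightarrow> nat) \<Rightarrow> bool" where
  "proper_edge_coloring E t \<alpha> \<longleftrightarrow>
     \<alpha> ` E \<subseteq> {1..t} \<and>
     (\<forall>e\<in>E. \<forall>e'\<in>E. e \<noteq> e' \<and> e \<inter> e' \<noteq> {} \<longrightarrow> \<alpha> e \<noteq> \<alpha> e')"

definition spectrum :: "'v set set \<Rightarrow> 'v \<Rightarrow> ('v set \<Rightarrow> nat) \<Rightarrow> nat set" where
  "spectrum E v \<alpha> = \<alpha> ` {e \<in> E. v \<in> e}"

text \<open>The empty set counts as a set of consecutive integers (take \<open>a > b\<close>).\<close>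

definition consecutive :: "nat set \<Rightarrow> bool" where
  "consecutive A \<longleftrightarrow> (\<exists>a b. A = {a..b})"

definition cyclic_interval_coloring ::
    "'v set \<Rightarrow> 'v set set \<Rightarrow> nat \<Rightarrow> ('v set \<Rightarrow> nat) \<Rightarrow> bool" where
  "cyclic_interval_coloring V E t \<alpha> \<longleftrightarrow>
     proper_edge_coloring E t \<alpha> \<and>
     (\<forall>v\<in>V. consecutive (spectrum E v \<alpha>) \<or> consecutive ({1..t} - spectrum E v \<alpha>))"

end

theory Submission
  imports Defs
begin

text \<open>Number the vertices \<open>0, \<dots>, N - 1\<close> so that every part occupies a block of consecutive
  numbers, and colour the edge joining the vertices numbered \<open>x\<close> and \<open>y\<close> with \<open>(x + y) mod N + 1\<close>.
  For fixed \<open>x\<close> the map \<open>y \<mapsto> (x + y) mod N\<close> is a rotation, so the colouring is proper, and the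
  colours missing at a vertex are the rotated block of its own part, which is a cyclic interval.\<close>

text \<open>Induction on \<open>r\<close>: the new part receives the numbers directly after those
  used so far. Being disjoint from the earlier parts, it leaves their blocks unchanged.\<close>

lemma exists_block_numbering:
  assumes "finite (\<Union>i\<in>{1..r::nat}. P i)" and "disjoint_family_on P {1..r}"
  shows "\<exists>f::'v \<Rightarrow> nat. bij_betw f (\<Union>i\<in>{1..r}. P i) {..<\<Sum>i=1..r. card (P i)} \<and>
           (\<forall>i\<in>{1..r}. \<exists>a b. f ` P i = {a..<b})"
  using assms
proof (induction r)
  case 0
  show ?case by (simp add: bij_betw_def)
next
  case (Suc r)
  let ?U = "\<Union>i\<in>{1..r}. P i" and ?W = "P (Suc r)" and ?N = "\<Sum>i=1..r. card (P i)"
  have split: "(\<Union>i\<in>{1..Suc r}. P i) = ?U \<union> ?W"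
    by (auto simp: atLeastAtMostSuc_conv)
  have fin: "finite ?U" "finite ?W"
    using Suc.prems(1) unfolding split by simp_all
  have disj: "?U \<inter> ?W = {}"
  proof -
    have "P i \<inter> ?W = {}" if "i \<in> {1..r}" for i
      using that by (intro disjoint_family_onD[OF Suc.prems(2)]) auto
    then show ?thesis by blast
  qed
  have "disjoint_family_on P {1..r}"
    using Suc.prems(2) by (auto simp: disjoint_family_on_def)
  with Suc.IH fin obtain f where f: "bij_betw f ?U {..<?N}"
    and blk: "\<forall>i\<in>{1..r}. \<exists>a b. f ` P i = {a..<b}" by blast
  obtain h where h: "bij_betw h ?W {0..<card ?W}"
    using ex_bij_betw_finite_nat[OF fin(2)] by blast
  have shift: "bij_betw ((+) ?N) {0..<card ?W} {?N..<?N + card ?W}"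
    by (auto simp: bij_betw_def)
  define g where "g = (\<lambda>v. if v \<in> ?W then ?N + h v else f v)"
  have gU: "bij_betw g ?U {..<?N}"
    using f disj by (subst bij_betw_cong[of _ _ f]) (auto simp: g_def)
  have gW: "bij_betw g ?W {?N..<?N + card ?W}"
    using bij_betw_trans[OF h shift] by (subst bij_betw_cong[of _ _ "(+) ?N \<circ> h"]) (auto simp: g_def)
  have "bij_betw g (?U \<union> ?W) ({..<?N} \<union> {?N..<?N + card ?W})"
    by (rule bij_betw_combine[OF gU gW]) auto
  moreover have "{..<?N} \<union> {?N..<?N + card ?W} = {..<\<Sum>i=1..Suc r. card (P i)}"
    by auto
  ultimately have "bij_betw g (\<Union>i\<in>{1..Suc r}. P i) {..<\<Sum>i=1..Suc r. card (P i)}"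
    unfolding split by simp
  moreover have "\<exists>a b. g ` P i = {a..<b}" if "i \<in> {1..Suc r}" for i
  proof (cases "i = Suc r")
    case True
    then show ?thesis using gW by (auto simp: bij_betw_def)
  next
    case False
    with that have i: "i \<in> {1..r}" by auto
    then have "P i \<inter> ?W = {}" using disj by blast
    then have "g ` P i = f ` P i"
      by (intro image_cong) (auto simp: g_def)
    then show ?thesis using blk i by simp
  qed
  ultimately show ?case by blast
qed

lemma inj_on_rotation: "inj_on (\<lambda>j. (c + j) mod N + 1) {..<N::nat}"
proof (rule inj_onI)
  fix j k assume jk: "j \<in> {..<N}" "k \<in> {..<N}" "(c + j) mod N + 1 = (c + k) mod N + 1"
  \<comment> \<open>Over the integers \<open>c\<close> can be cancelled by subtracting it modulo
    \<open>N\<close>; subtraction on the naturals would truncate.\<close>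
  have "(int c + int j) mod int N = (int c + int k) mod int N"
    using jk(3) by (metis add_right_cancel of_nat_add of_nat_mod)
  then have "int j mod int N = int k mod int N"
    by (metis add_diff_cancel_left' mod_diff_left_eq)
  then show "j = k" using jk(1,2) by simp
qed

text \<open>Surjectivity comes from counting: the map is injective between sets of \<open>N\<close>
  elements.\<close>

lemma rotation_image: "(\<lambda>j. (c + j) mod N + 1) ` {..<N::nat} = {1..N}"
proof (rule card_subset_eq)
  show "(\<lambda>j. (c + j) mod N + 1) ` {..<N} \<subseteq> {1..N}"
    by (auto simp: Suc_le_eq)
  show "card ((\<lambda>j. (c + j) mod N + 1) ` {..<N}) = card {1..N}"
    by (simp only: card_image[OF inj_on_rotation]) simp
qed simp

text \<open>The hypothesis keeps the subtraction from truncating, so the map is a translation. It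
  serves twice below: with 0 in place of \<open>N\<close> before the rotation wraps around, and with
  \<open>N\<close> itself afterwards.\<close>

lemma image_shift_down:
  fixes a b c N :: nat
  assumes "N \<le> c + a"
  shows "(\<lambda>j. c + j - N + 1) ` {a..<b} = {c + a - N + 1..<c + b - N + 1}"
proof (intro equalityI subsetI)
  fix x assume "x \<in> {c + a - N + 1..<c + b - N + 1}"
  with assms show "x \<in> (\<lambda>j. c + j - N + 1) ` {a..<b}"
    by (intro image_eqI[of _ _ "x + N - 1 - c"]) auto
qed (use assms in auto)

text \<open>If the interval lies on one side of the wrapping point, its rotation is again an
  interval. Otherwise the image consists of an initial and a final piece of \<open>{1..N}\<close>,
  and the gap between them is an interval.\<close>

lemma rotated_interval_cyclic:
  fixes a b c N :: nat
  assumes "c < N" "b \<le> N"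
  defines "A \<equiv> (\<lambda>j. (c + j) mod N + 1) ` {a..<b}"
  shows "consecutive A \<or> consecutive ({1..N} - A)"
proof -
  have low: "(\<lambda>j. (c + j) mod N + 1) ` {x..<y} = {c + x + 1..<c + y + 1}" if "c + y \<le> N" for x y
  proof -
    have "(\<lambda>j. (c + j) mod N + 1) ` {x..<y} = (\<lambda>j. c + j - 0 + 1) ` {x..<y}"
      using that by (intro image_cong) auto
    then show ?thesis using image_shift_down[of 0 c x y] by simp
  qed
  have high: "(\<lambda>j. (c + j) mod N + 1) ` {x..<y} = {c + x - N + 1..<c + y - N + 1}"
    if "N \<le> c + x" "y \<le> N" for x y
  proof -
    have "(c + j) mod N = c + j - N" if "j \<in> {x..<y}" for j
    proof -
      have "N \<le> c + j" "c + j - N < N"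
        using that \<open>N \<le> c + x\<close> \<open>y \<le> N\<close> assms(1) by auto
      then show ?thesis by (simp add: le_mod_geq)
    qed
    then have "(\<lambda>j. (c + j) mod N + 1) ` {x..<y} = (\<lambda>j. c + j - N + 1) ` {x..<y}"
      by (intro image_cong) auto
    then show ?thesis using image_shift_down[of N c x y] that by simp
  qed
  have interval: "consecutive {x + 1..<y + 1}" for x y
    unfolding consecutive_def by (metis Suc_eq_plus1 atLeastLessThanSuc_atLeastAtMost)
  consider "c + b \<le> N" | "N \<le> c + a" | "c + a < N" "N < c + b" by linarith
  then show ?thesis
  proof cases
    case 1
    then show ?thesis unfolding A_def by (simp only: low interval simp_thms)
  next
    case 2
    then show ?thesis unfolding A_def by (simp only: high[OF 2 assms(2)] interval simp_thms)
  next
    case 3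
    \<comment> \<open>\<open>N - c\<close> is the argument that the rotation sends to residue
      0.\<close>
    have "{a..<b} = {a..<N - c} \<union> {N - c..<b}" using 3 by auto
    then have "A = {c + a + 1..<N + 1} \<union> {1..<c + b - N + 1}"
      unfolding A_def using low[of "N - c" a] high[of "N - c" b] 3 assms by (simp add: image_Un)
    then have "{1..N} - A = {c + b - N + 1..<c + a + 1}" using 3 assms by auto
    then show ?thesis by (simp only: interval simp_thms)
  qed
qed

theorem theorem6:
  fixes r :: nat and n :: "nat \<Rightarrow> nat" and V :: "'v set" and E :: "'v set set"
  assumes "r \<ge> 2"
    and "\<forall>i\<in>{1..r}. n i > 0"
    and "complete_multipartite r n V E"
  shows "\<exists>\<alpha>. cyclic_interval_coloring V E (\<Sum>i=1..r. n i) \<alpha>"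
proof -
  from assms(3) obtain P where fin: "finite V" and edges: "\<forall>e\<in>E. e \<subseteq> V \<and> card e = 2"
    and V: "V = (\<Union>i\<in>{1..r}. P i)" and disj: "disjoint_family_on P {1..r}"
    and parts: "\<forall>i\<in>{1..r}. card (P i) = n i \<and> independent_set E (P i)"
    and adj: "\<forall>i\<in>{1..r}. \<forall>j\<in>{1..r}. i \<noteq> j \<longrightarrow> (\<forall>u\<in>P i. \<forall>v\<in>P j. {u, v} \<in> E)"
    unfolding complete_multipartite_def simple_graph_def by blast
  define N where "N = (\<Sum>i=1..r. n i)"
  have "(\<Sum>i=1..r. card (P i)) = N" using parts by (simp add: N_def)
  then obtain f where f: "bij_betw f V {..<N}"
    and blocks: "\<forall>i\<in>{1..r}. \<exists>a b. f ` P i = {a..<b}"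
    using exists_block_numbering[of P r] fin disj unfolding V by auto
  have inj: "inj_on f V" and img: "f ` V = {..<N}" using f by (auto simp: bij_betw_def)
  define rot where "rot x j = (x + j) mod N + 1" for x j
  have rot_inj: "inj_on (rot x) {..<N}" and rot_img: "rot x ` {..<N} = {1..N}" for x
    using inj_on_rotation rotation_image unfolding rot_def by blast+
  \<comment> \<open>Summing over the edge as a set avoids choosing an order of its ends; adding 1
    moves the residues into \<open>{1..N}\<close>.\<close>
  define \<alpha> where "\<alpha> e = sum f e mod N + 1" for e
  have \<alpha>: "\<alpha> {u, v} = rot (f u) (f v)" if "u \<noteq> v" for u v
    using that by (simp add: \<alpha>_def rot_def)
  have other: "\<exists>v. e = {u, v} \<and> u \<noteq> v \<and> v \<in> V" if "e \<in> E" "u \<in> e" for e u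
  proof -
    have e: "e \<subseteq> V" "card e = 2" using edges that(1) by auto
    then obtain v w where "e = {v, w}" "v \<noteq> w" by (auto simp: card_2_iff)
    with e(1) that(2) show ?thesis by (auto simp: insert_commute)
  qed
  have "proper_edge_coloring E N \<alpha>"
    unfolding proper_edge_coloring_def
  proof (intro conjI ballI impI)
    show "\<alpha> ` E \<subseteq> {1..N}"
    proof (rule image_subsetI)
      fix e assume e: "e \<in> E"
      then have "e \<noteq> {}" using edges by force
      then obtain u where u: "u \<in> e" by blast
      then obtain v where "e = {u, v}" "u \<noteq> v" "v \<in> V" using other[OF e] by blast
      then show "\<alpha> e \<in> {1..N}" using \<alpha> rot_img[of "f u"] img by blast
    qed
  next
    fix e e' assume e: "e \<in> E" and e': "e' \<in> E" and ne: "e \<noteq> e' \<and> e \<inter> e' \<noteq> {}"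
    then obtain u where u: "u \<in> e" "u \<in> e'" by blast
    obtain v where v: "e = {u, v}" "u \<noteq> v" "v \<in> V" using other[OF e u(1)] by blast
    obtain w where w: "e' = {u, w}" "u \<noteq> w" "w \<in> V" using other[OF e' u(2)] by blast
    \<comment> \<open>Distinct edges at \<open>u\<close> differ in their other ends, so their
      colours are values of one injective rotation at different arguments.\<close>
    have "f v \<noteq> f w" using v w ne by (auto simp: inj_on_eq_iff[OF inj])
    then have "rot (f u) (f v) \<noteq> rot (f u) (f w)"
      using inj_on_eq_iff[OF rot_inj] img v(3) w(3) by blast
    then show "\<alpha> e \<noteq> \<alpha> e'" using \<alpha> v w by simp
  qed
  moreover have "consecutive (spectrum E u \<alpha>) \<or> consecutive ({1..N} - spectrum E u \<alpha>)"
    if "u \<in> V" for u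
  proof -
    obtain i where i: "i \<in> {1..r}" "u \<in> P i" using \<open>u \<in> V\<close> V by blast
    obtain a b where ab: "f ` P i = {a..<b}" using blocks i by blast
    have PV: "P i \<subseteq> V" using V i by blast
    have fu: "f u \<in> {a..<b}" using ab i by blast
    have sub: "{a..<b} \<subseteq> {..<N}" using PV img ab by blast
    have "{u, v} \<in> E \<longleftrightarrow> v \<in> V - P i" for v
    proof
      assume "{u, v} \<in> E"
      then show "v \<in> V - P i"
        using edges parts i unfolding independent_set_def by blast
    next
      assume "v \<in> V - P i"
      then obtain j where "j \<in> {1..r}" "v \<in> P j" "i \<noteq> j" using V by blast
      then show "{u, v} \<in> E" using adj i by simp
    qed
    then have "{e \<in> E. u \<in> e} = (\<lambda>v. {u, v}) ` (V - P i)"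
      using other[of _ u] by fast
    then have "spectrum E u \<alpha> = (\<lambda>v. \<alpha> {u, v}) ` (V - P i)"
      by (simp add: spectrum_def image_image)
    also have "\<dots> = (\<lambda>v. rot (f u) (f v)) ` (V - P i)"
      using i by (intro image_cong) (auto intro!: \<alpha>)
    \<comment> \<open>Injectivity, first of \<open>f\<close> and then of the rotation, carries the
      set difference through the image.\<close>
    also have "\<dots> = rot (f u) ` (f ` V - f ` P i)"
      using inj_on_image_set_diff[OF inj _ PV, of V] by (simp flip: image_image)
    also have "\<dots> = {1..N} - rot (f u) ` {a..<b}"
      using inj_on_image_set_diff[OF rot_inj _ sub, of "{..<N}"] by (simp add: ab img rot_img)
    finally have spec: "spectrum E u \<alpha> = {1..N} - rot (f u) ` {a..<b}" .
    have "rot (f u) ` {a..<b} \<subseteq> {1..N}" using rot_img sub by blast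
    then have co: "{1..N} - spectrum E u \<alpha> = rot (f u) ` {a..<b}" using spec by blast
    have "f u < N" using fu sub by blast
    moreover have "b \<le> N"
    proof -
      \<comment> \<open>The block contains \<open>f u\<close>; an empty block would give no bound on
        \<open>b\<close>.\<close>
      have "b - 1 \<in> {a..<b}" using fu by auto
      then have "b - 1 \<in> {..<N}" using sub by blast
      then show ?thesis by auto
    qed
    \<comment> \<open>The lemma is applied to the set of missing colours, so its two alternatives
      appear here in exchanged order.\<close>
    ultimately show ?thesis
      using rotated_interval_cyclic[of "f u" N b a] co spec unfolding rot_def by auto
  qed
  ultimately show ?thesis unfolding cyclic_interval_coloring_def N_def by blast
qed

end
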